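(* For $\lambda\ge 0$ consider the boundary value problem $$r^2w''(r)-rw'(r)=\frac{\lambda}{2}r^4+\frac{w^2(r)}{2}\quad\text{for } r\in(0,1],\qquad \lim_{r\to 0_+}w'(r)=0,\qquad w(1)=0. \qquad (D_\lambda)$$ There exists a real number $\lambda_0>0$ such that problem $(D_\lambda)$ is solvable for every $\lambda\in[0,\lambda_0)$ and there is no solution to problem $(D_\lambda)$ if $\lambda>\lambda_0$. Furthermore, for every $\lambda\ge 0$, every solution $w$ to $(D_\lambda)$ satisfies $$w(r)\le 0\quad\text{for } r\in(0,1],\qquad \lim_{r\to 0_+}w(r)=0.$$
   Context: A solution is a real-valued function $w:(0,1]\to\mathbb{R}$ which is of class $C^2$ on every compact interval $[a,b]\subseteq(0,1]$ (one-sided derivatives at the endpoint $r=1$), satisfies the differential equation for all $r\in(0,1]$ and satisfies the stated conditions. Under the substitution $t=r^2/2$, $u(t)=w(r)$ the problem is equivalent to $u''=\frac{u^2}{8t^2}+\frac{\lambda}{2}$ on $(0,1/2]$, $\lim_{t\to0_+}\sqrt{t}\,u'(t)=0$, $u(1/2)=0$. *)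

theory Defs
  imports "HOL-Analysis.Analysis"
begin

text \<open>
  \<open>w\<close> is of class $C^2$ on \<open>S\<close> with first and second derivatives \<open>w1\<close> and \<open>w2\<close>. Derivatives are
  taken within \<open>S\<close>, hence one-sided at the endpoints of an interval. Points of \<open>S\<close> are assumed to
  be limit points of \<open>S\<close> (otherwise the derivative is not unique), which is why only
  nondegenerate intervals are used below.
\<close>

definition C2_on_with ::
  "real set \<Rightarrow> (real \<Rightarrow> real) \<Rightarrow> (real \<Rightarrow> real) \<Rightarrow> (real \<Rightarrow> real) \<Rightarrow> bool" where
  "C2_on_with S w w1 w2 \<longleftrightarrow>
     (\<forall>r\<in>S. (w has_real_derivative w1 r) (at r within S)) \<and>
     (\<forall>r\<in>S. (w1 has_real_derivative w2 r) (at r within S)) \<and>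
     continuous_on S w2"

text \<open>
  Only the values of \<open>w\<close> on $(0,1]$ matter, and there \<open>w1\<close> and \<open>w2\<close> are uniquely determined
  as the derivatives $w'$ and $w''$ (one-sided at $1$).
\<close>

definition solution_D :: "real \<Rightarrow> (real \<Rightarrow> real) \<Rightarrow> bool" where
  "solution_D lam w \<longleftrightarrow>
     (\<exists>w1 w2.
        (\<forall>a b. 0 < a \<and> a < b \<and> b \<le> 1 \<longrightarrow> C2_on_with {a..b} w w1 w2) \<and>
        (\<forall>r\<in>{0<..1}. r\<^sup>2 * w2 r - r * w1 r = lam / 2 * r ^ 4 + (w r)\<^sup>2 / 2) \<and>
        (w1 \<longlongrightarrow> 0) (at_right 0) \<and>
        w 1 = 0)"

end

theory Submission
  imports Defs
begin

text \<open>
  Everything is expressed through the slope \<open>v r = w' r / r\<close>, which is the derivative of \<open>w\<close>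
  with respect to \<open>t = r\<^sup>2 / 2\<close>. The differential equation becomes the first order system
  \<open>w' = r v\<close>, \<open>v' = lam r / 2 + w\<^sup>2 / (2 r\<^sup>3)\<close>, so for \<open>lam \<ge> 0\<close> the slope \<open>v\<close> is nondecreasing: in the
  variable \<open>t\<close> every solution is convex.

  Sign and limit at \<open>0\<close>. Near \<open>0\<close> the function \<open>w\<close> is Lipschitz. If it stayed away from zero, the
  term \<open>w\<^sup>2 / (2 r\<^sup>3)\<close> would drive \<open>v\<close> down to minus infinity like \<open>- c / r\<^sup>2\<close>, against
  \<open>r v \<rightarrow> 0\<close>. Hence \<open>w \<rightarrow> 0\<close> (\<open>w_tendsto_0\<close>), and a convex function that vanishes at both ends is
  nonpositive (\<open>w_nonpos\<close>).

  The parameters of solvable problems are bounded (\<open>lam_bound\<close>). Test the equation against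
  \<open>sin (pi r\<^sup>2) = sin (2 pi t)\<close>, the first Dirichlet eigenfunction on \<open>0 < t < 1/2\<close>: the Wronskian
  of the two functions vanishes at both ends but is strictly monotone as soon as the quadratic
  \<open>x\<^sup>2 + 8 pi\<^sup>2 x + lam\<close> has no real zero.

  Existence below a supersolution (\<open>supersolution.solution_exists\<close>). For \<open>y = - w \<ge> 0\<close> the problem
  is a fixed point equation \<open>y = green lam y\<close> for the integral operator with the Dirichlet Green
  function. Since the kernel is nonnegative and the nonlinearity increases with \<open>y \<ge> 0\<close>, this
  operator is monotone. Starting from \<open>0\<close>, its iterates increase and stay below any supersolution
  \<open>X\<close>; dominated convergence shows that their limit is a fixed point, and the bounds inherited
  from \<open>X\<close> give the boundary conditions.

  If \<open>w\<close> solves the problem for \<open>mu\<close>, then \<open>- w\<close> is a supersolution for each \<open>lam\<close> with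
  \<open>0 \<le> lam \<le> mu\<close>, so solvability is inherited downwards (\<open>solvable_downward\<close>). The function
  \<open>r\<^sup>2 (1 - r\<^sup>2) / 4\<close> is a supersolution for \<open>lam = 1\<close> (\<open>solvable_one\<close>). Therefore the supremum of
  the nonnegative parameters that admit a solution is finite and positive, and it is the
  threshold.
\<close>

section \<open>The equation as a first order system\<close>


definition source :: "real \<Rightarrow> (real \<Rightarrow> real) \<Rightarrow> real \<Rightarrow> real" where
  "source lam y r = lam * r / 2 + (y r)\<^sup>2 / (2 * r ^ 3)"

lemma source_uminus: "source lam (\<lambda>r. - w r) = source lam w"
  by (simp add: source_def fun_eq_iff)

lemma source_nonneg: "lam \<ge> 0 \<Longrightarrow> r > 0 \<Longrightarrow> source lam y r \<ge> 0"
  by (simp add: source_def)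

text \<open>
  Derivatives at points of \<open>{0<..1}\<close> may be taken within any compact subinterval that reaches
  further to the left, which is how statements on compact intervals and on the half-open interval
  are exchanged.
\<close>
lemma at_within_unit_eq:
  fixes r :: real
  assumes "0 < a" "a < r" "r \<le> 1"
  shows "at r within {a..1} = at r within {0<..1}"
  by (rule at_within_nhd[where S = "{a<..}"]) (use assms in auto)

text \<open>
  The derivative of \<open>w1 r / r\<close> is \<open>(r\<^sup>2 w2 r - r w1 r) / r\<^sup>3\<close>, and the numerator is the left-hand
  side of the differential equation. In the converse direction the continuity of \<open>w2 = v + r v'\<close> is
  recovered from the equation for \<open>v\<close>, whose right-hand side is continuous.
\<close>
lemma solution_D_iff_slope:
  "solution_D lam w \<longleftrightarrow>
     (\<exists>v. (\<forall>r\<in>{0<..1}. (w has_real_derivative r * v r) (at r within {0<..1})) \<and>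
          (\<forall>r\<in>{0<..1}. (v has_real_derivative source lam w r) (at r within {0<..1})) \<and>
          ((\<lambda>r. r * v r) \<longlongrightarrow> 0) (at_right 0) \<and> w 1 = 0)"
  (is "_ \<longleftrightarrow> (\<exists>v. ?P v)")
proof
  assume "solution_D lam w"
  then obtain w1 w2 where C2: "\<And>a b. 0 < a \<Longrightarrow> a < b \<Longrightarrow> b \<le> 1 \<Longrightarrow> C2_on_with {a..b} w w1 w2"
    and ode: "\<And>r. r \<in> {0<..1} \<Longrightarrow> r\<^sup>2 * w2 r - r * w1 r = lam / 2 * r ^ 4 + (w r)\<^sup>2 / 2"
    and lim: "(w1 \<longlongrightarrow> 0) (at_right 0)" and w1: "w 1 = 0"
    unfolding solution_D_def by blast
  have D: "(w has_real_derivative w1 r) (at r within {0<..1})"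
          "(w1 has_real_derivative w2 r) (at r within {0<..1})" if r: "r \<in> {0<..1}" for r
  proof -
    have "C2_on_with {r/2..1} w w1 w2" using r by (intro C2) auto
    moreover have "r \<in> {r/2..1}" using r by auto
    ultimately show "(w has_real_derivative w1 r) (at r within {0<..1})"
          "(w1 has_real_derivative w2 r) (at r within {0<..1})"
      using at_within_unit_eq[of "r/2" r] r unfolding C2_on_with_def
      by (metis greaterThanAtMost_iff half_gt_zero field_sum_of_halves less_add_same_cancel1)+
  qed
  have "?P (\<lambda>r. w1 r / r)"
  proof (intro conjI ballI)
    fix r :: real assume r: "r \<in> {0<..1}"
    show "(w has_real_derivative r * (w1 r / r)) (at r within {0<..1})" using D(1)[OF r] r by simp
    have "(r * w2 r - w1 r) / r\<^sup>2 = (r\<^sup>2 * w2 r - r * w1 r) / r ^ 3"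
      using r by (simp add: field_simps power2_eq_square power3_eq_cube)
    also have "\<dots> = source lam w r"
      unfolding ode[OF r] source_def using r by (simp add: field_simps power2_eq_square eval_nat_numeral)
    finally have eq: "(w2 r * r - w1 r * 1) / (r * r) = source lam w r"
      by (simp add: power2_eq_square mult.commute)
    show "((\<lambda>r. w1 r / r) has_real_derivative source lam w r) (at r within {0<..1})"
      unfolding eq[symmetric] using r by (intro DERIV_divide D(2) DERIV_ident) auto
  next
    have "eventually (\<lambda>r::real. w1 r = r * (w1 r / r)) (at_right 0)"
      using eventually_at_right_less[of 0] by eventually_elim auto
    then show "((\<lambda>r. r * (w1 r / r)) \<longlongrightarrow> 0) (at_right 0)"
      using lim by (rule Lim_transform_eventually[rotated])
  qed (rule w1)
  then show "\<exists>v. ?P v" by (rule exI[of ?P])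
next
  assume "\<exists>v. ?P v"
  then obtain v where v: "?P v" by (rule exE)
  then have D: "\<And>r. r \<in> {0<..1} \<Longrightarrow> (w has_real_derivative r * v r) (at r within {0<..1})"
     "\<And>r. r \<in> {0<..1} \<Longrightarrow> (v has_real_derivative source lam w r) (at r within {0<..1})"
     and lim: "((\<lambda>r. r * v r) \<longlongrightarrow> 0) (at_right 0)" and w1: "w 1 = 0" by simp_all
  let ?w2 = "\<lambda>r. v r + r * source lam w r"
  have contw: "continuous_on {0<..1} w" and contv: "continuous_on {0<..1} v"
    using DERIV_continuous_on[OF D(1)] DERIV_continuous_on[OF D(2)] by simp_all
  have "continuous_on {0<..1} ?w2"
    unfolding source_def by (intro continuous_intros contw contv) auto
  then have C2: "C2_on_with {a..b} w (\<lambda>r. r * v r) ?w2" if "0 < a" "a < b" "b \<le> 1" for a b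
    unfolding C2_on_with_def
  proof (intro conjI ballI)
    have sub: "{a..b} \<subseteq> {0<..1}" using that by auto
    fix r assume r: "r \<in> {a..b}"
    then have r': "r \<in> {0<..1}" using sub by auto
    show "(w has_real_derivative r * v r) (at r within {a..b})"
      using D(1)[OF r'] sub DERIV_subset by blast
    have "((\<lambda>r. r * v r) has_real_derivative ?w2 r) (at r within {0<..1})"
      by (rule derivative_eq_intros D(2)[OF r'] refl | simp)+
    then show "((\<lambda>r. r * v r) has_real_derivative ?w2 r) (at r within {a..b})"
      using sub DERIV_subset by blast
  next
    show "continuous_on {a..b} ?w2" if "continuous_on {0<..1} ?w2"
      using that \<open>0<a\<close> \<open>b\<le>1\<close> by (elim continuous_on_subset) auto
  qed
  have ode: "r\<^sup>2 * ?w2 r - r * (r * v r) = lam / 2 * r ^ 4 + (w r)\<^sup>2 / 2" if "r \<in> {0<..1}" for r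
    using that unfolding source_def by (simp add: field_simps power2_eq_square eval_nat_numeral)
  show "solution_D lam w" unfolding solution_D_def
    by (rule exI[of _ "\<lambda>r. r * v r"], rule exI[of _ ?w2], intro conjI allI impI ballI)
       (use C2 ode lim w1 in simp_all)
qed

text \<open>
  Only the values of the derivative on \<open>{s..t}\<close> must be nonnegative, while differentiability is
  available within \<open>{0<..1}\<close>, where the derivative at the endpoint \<open>1\<close> is one-sided.
\<close>
lemma nondecreasing_unit:
  fixes f f' :: "real \<Rightarrow> real"
  assumes D: "\<And>r. r \<in> {0<..1} \<Longrightarrow> (f has_real_derivative f' r) (at r within {0<..1})"
    and nn: "\<And>r. s \<le> r \<Longrightarrow> r \<le> t \<Longrightarrow> f' r \<ge> 0" and st: "0 < s" "s \<le> t" "t \<le> 1"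
  shows "f s \<le> f t"
proof (rule DERIV_nonneg_imp_increasing_open[OF st(2)])
  have "continuous_on {0<..1} f" using D DERIV_continuous_on by blast
  then show "continuous_on {s..t} f" using st by (elim continuous_on_subset) auto
  fix r assume r: "s < r" "r < t"
  have "at r within {0<..1} = at r" using r st by (intro at_within_open_subset[of _ "{0<..<1}"]) auto
  then show "\<exists>y. (f has_real_derivative y) (at r) \<and> 0 \<le> y"
    using D[of r] nn[of r] r st by auto
qed

section \<open>Properties of solutions\<close>
locale solution =
  fixes lam :: real and w v :: "real \<Rightarrow> real"
  assumes lam_nonneg: "lam \<ge> 0"
    and deriv_w: "r \<in> {0<..1} \<Longrightarrow> (w has_real_derivative r * v r) (at r within {0<..1})"
    and deriv_v: "r \<in> {0<..1} \<Longrightarrow> (v has_real_derivative source lam w r) (at r within {0<..1})"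
    and lim_rv: "((\<lambda>r. r * v r) \<longlongrightarrow> 0) (at_right 0)"
    and w_1: "w 1 = 0"
begin

lemma slope_mono: "0 < s \<Longrightarrow> s \<le> t \<Longrightarrow> t \<le> 1 \<Longrightarrow> v s \<le> v t"
  by (rule nondecreasing_unit[OF deriv_v]) (auto intro: source_nonneg lam_nonneg)

text \<open>
  Since \<open>\<bar>w'\<bar> < 1\<close> near \<open>0\<close>, a value \<open>\<bar>w r0\<bar> \<ge> e\<close> at one small \<open>r0\<close> forces \<open>\<bar>w\<bar> \<ge> e / 2\<close> on all of
  \<open>{0<..r0}\<close>. Then \<open>v' \<ge> 2 c / r\<^sup>3\<close> with \<open>c = e\<^sup>2 / 16\<close>, so \<open>v + c / s\<^sup>2\<close> stays bounded above as
  \<open>s \<rightarrow> 0\<close>. After multiplication by \<open>s\<^sup>2\<close> this contradicts \<open>s (s v s) \<rightarrow> 0\<close>.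
\<close>
lemma w_tendsto_0: "(w \<longlongrightarrow> 0) (at_right 0)"
proof (rule tendstoI)
  fix e :: real assume e: "e > 0"
  have "eventually (\<lambda>r. \<bar>r * v r\<bar> < 1) (at_right 0)"
    using tendstoD[OF lim_rv, of 1] by (simp add: dist_real_def)
  then obtain d0 where d0: "d0 > 0" "\<And>r. 0 < r \<Longrightarrow> r < d0 \<Longrightarrow> \<bar>r * v r\<bar> < 1"
    unfolding eventually_at_right_field by auto
  \<comment> \<open>The bound \<open>e / 2\<close> on the radius keeps the variation of \<open>w\<close> below \<open>e / 2\<close>.\<close>
  define d where "d = min d0 (min 1 (e / 2))"
  have d: "0 < d" "d \<le> d0" "d \<le> 1" "d \<le> e / 2" unfolding d_def using d0(1) e by auto
  have "\<bar>w r0\<bar> < e" if r0: "0 < r0" "r0 < d" for r0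
  proof (rule ccontr)
    assume "\<not> \<bar>w r0\<bar> < e"
    have big: "\<bar>w s\<bar> \<ge> e / 2" if s: "0 < s" "s \<le> r0" for s
    proof -
      have rv: "\<bar>r * v r\<bar> < 1" if "s \<le> r" "r \<le> r0" for r
        using d0(2)[of r] that s r0 d by simp
      have "w s + s \<le> w r0 + r0"
        using s r0 d rv
        by (intro nondecreasing_unit[OF DERIV_add[OF deriv_w DERIV_ident]]) (auto, smt (verit))
      moreover have "- w s + s \<le> - w r0 + r0"
        using s r0 d rv
        by (intro nondecreasing_unit[OF DERIV_add[OF DERIV_minus[OF deriv_w] DERIV_ident]])
           (auto, smt (verit))
      ultimately show ?thesis using \<open>\<not> \<bar>w r0\<bar> < e\<close> s r0 d by linarith
    qed
    define c where "c = e\<^sup>2 / 16"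
    have c: "c > 0" unfolding c_def using e by simp
    have grow: "v s + c / s\<^sup>2 \<le> v r0 + c / r0\<^sup>2" if s: "0 < s" "s \<le> r0" for s
    proof (rule nondecreasing_unit[where f = "\<lambda>s. v s + c / s\<^sup>2" and f' = "\<lambda>r. source lam w r - 2 * c / r ^ 3"])
      fix r :: real assume r: "r \<in> {0<..1}"
      have "((\<lambda>r. c / r\<^sup>2) has_real_derivative - (2 * c / r ^ 3)) (at r within {0<..1})"
        using r by (auto intro!: derivative_eq_intros simp: field_simps eval_nat_numeral)
      from DERIV_add[OF deriv_v[OF r] this]
      show "((\<lambda>s. v s + c / s\<^sup>2) has_real_derivative source lam w r - 2 * c / r ^ 3) (at r within {0<..1})"
        by simp
    next
      fix r assume r: "s \<le> r" "r \<le> r0"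
      have "(e / 2)\<^sup>2 \<le> (w r)\<^sup>2" using big[of r] r s e
        by (metis abs_le_square_iff abs_of_pos half_gt_zero less_le_trans)
      then have "4 * c / (2 * r ^ 3) \<le> (w r)\<^sup>2 / (2 * r ^ 3)"
        using r s by (intro divide_right_mono) (auto simp: c_def power2_eq_square)
      then show "0 \<le> source lam w r - 2 * c / r ^ 3"
        using r s lam_nonneg by (simp add: source_def add_increasing)
    qed (use s r0 d in auto)
    have "s * (s * v s) + c \<le> s\<^sup>2 * (v r0 + c / r0\<^sup>2)" if s: "0 < s" "s < r0" for s
    proof -
      have "s\<^sup>2 * (v s + c / s\<^sup>2) \<le> s\<^sup>2 * (v r0 + c / r0\<^sup>2)"
        using s by (intro mult_left_mono grow) auto
      then show ?thesis using s by (simp add: distrib_left power2_eq_square)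
    qed
    then have ev: "eventually (\<lambda>s. s * (s * v s) + c \<le> s\<^sup>2 * (v r0 + c / r0\<^sup>2)) (at_right 0)"
      unfolding eventually_at_right_field using r0 by blast
    have "((\<lambda>s. s * (s * v s) + c) \<longlongrightarrow> 0 * 0 + c) (at_right 0)"
      by (intro tendsto_intros lim_rv)
    moreover have "((\<lambda>s::real. s\<^sup>2 * (v r0 + c / r0\<^sup>2)) \<longlongrightarrow> 0\<^sup>2 * (v r0 + c / r0\<^sup>2)) (at_right 0)"
      by (intro tendsto_intros)
    \<comment> \<open>The limit of the inequality at \<open>0\<close>, with both sides in the form the limit rules give.\<close>
    ultimately have "0 * 0 + c \<le> 0\<^sup>2 * (v r0 + c / r0\<^sup>2)"
      using ev by (intro tendsto_le[of "at_right 0"]) auto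
    then show False using c by simp
  qed
  then show "eventually (\<lambda>r. dist (w r) 0 < e) (at_right 0)"
    unfolding eventually_at_right_field using d(1) by auto
qed

text \<open>
  If \<open>w r0 > 0 = w 1\<close>, then \<open>w\<close> cannot increase on all of \<open>{r0..1}\<close>, so \<open>v r0 < 0\<close>. By monotonicity of
  \<open>v\<close> the function \<open>w\<close> decreases on \<open>{0<..r0}\<close> and stays above \<open>w r0\<close> there, which is impossible
  because \<open>w \<rightarrow> 0\<close>.
\<close>
lemma w_nonpos:
  assumes r0: "r0 \<in> {0<..1}"
  shows "w r0 \<le> 0"
proof (rule ccontr)
  assume "\<not> w r0 \<le> 0"
  then have pos: "w r0 > 0" by simp
  have v0: "v r0 < 0"
  proof (rule ccontr)
    assume "\<not> v r0 < 0"
    then have "w r0 \<le> w 1"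
      using r0 slope_mono[of r0] by (intro nondecreasing_unit[OF deriv_w]) (force intro: mult_nonneg_nonneg)+
    then show False using pos w_1 by simp
  qed
  have "w r0 \<le> w s" if "0 < s" "s < r0" for s
  proof -
    have "- w s \<le> - w r0"
      using v0 r0 that slope_mono[of _ r0]
      by (intro nondecreasing_unit[OF DERIV_minus[OF deriv_w]])
         (auto intro!: mult_nonneg_nonpos, smt (verit))
    then show ?thesis by simp
  qed
  then have "eventually (\<lambda>s. w r0 \<le> w s) (at_right 0)"
    unfolding eventually_at_right_field using r0 by auto
  then have "w r0 \<le> 0" by (intro tendsto_lowerbound[OF w_tendsto_0]) auto
  then show False using pos by simp
qed

text \<open>
  With \<open>\<phi> = sin (pi r\<^sup>2)\<close> and \<open>t = r\<^sup>2 / 2\<close>, the function \<open>W = v \<phi> - w (d\<phi> / dt)\<close> is the Wronskian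
  of \<open>w\<close> and \<open>\<phi>\<close> with respect to \<open>t\<close>. Because \<open>d\<^sup>2\<phi> / dt\<^sup>2 = - 4 pi\<^sup>2 \<phi>\<close>, its derivative with respect
  to \<open>r\<close> is \<open>(v' + 4 pi\<^sup>2 r w) \<phi>\<close>. Completing the square shows that this is positive on the open
  interval if \<open>lam > 16 pi\<^sup>4\<close>, although \<open>W\<close> vanishes at \<open>0\<close> and \<open>1\<close>.
\<close>
lemma lam_bound: "lam \<le> 16 * pi ^ 4"
proof (rule ccontr)
  assume "\<not> lam \<le> 16 * pi ^ 4"
  then have lam: "lam > 16 * pi ^ 4" by simp
  define W where "W r = v r * sin (pi * r\<^sup>2) - 2 * pi * w r * cos (pi * r\<^sup>2)" for r
  define W' where "W' r = (source lam w r + 4 * pi\<^sup>2 * r * w r) * sin (pi * r\<^sup>2)" for r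
  have DW: "(W has_real_derivative W' r) (at r within {0<..1})" if r: "r \<in> {0<..1}" for r
    unfolding W_def W'_def
    by (rule derivative_eq_intros deriv_w[OF r] deriv_v[OF r] refl)+
       (simp add: algebra_simps power2_eq_square)
  have pos: "source lam w r + 4 * pi\<^sup>2 * r * w r > 0" if r: "r \<in> {0<..1}" for r
  proof -
    have "r * ((w r)\<^sup>2 / 2) \<le> (w r)\<^sup>2 / (2 * r ^ 3)"
    proof -
      have "(w r)\<^sup>2 * r ^ 4 \<le> (w r)\<^sup>2 * 1" using r by (intro mult_left_mono power_le_one) auto
      then show ?thesis using r by (simp add: field_simps eval_nat_numeral)
    qed
    moreover have "lam + 8 * pi\<^sup>2 * w r + (w r)\<^sup>2 = (lam - 16 * pi ^ 4) + (w r + 4 * pi\<^sup>2)\<^sup>2"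
      by (simp add: power2_eq_square eval_nat_numeral algebra_simps)
    then have "lam + 8 * pi\<^sup>2 * w r + (w r)\<^sup>2 > 0" using lam
      by (smt (verit) zero_le_power2)
    then have "r * (lam + 8 * pi\<^sup>2 * w r + (w r)\<^sup>2) > 0" using r by simp
    ultimately show ?thesis unfolding source_def by (simp add: algebra_simps)
  qed
  have sin_nn: "sin (pi * r\<^sup>2) \<ge> 0" if "r \<in> {0<..1}" for r
    using that power_le_one[of r 2] by (intro sin_ge_zero) auto
  have mono: "W s \<le> W t" if "0 < s" "s \<le> t" "t \<le> 1" for s t
    using that less_imp_le[OF pos] sin_nn by (intro nondecreasing_unit[OF DW])
       (auto simp: W'_def intro!: mult_nonneg_nonneg)
  have W1: "W 1 = 0" by (simp add: W_def w_1)
  have W0: "(W \<longlongrightarrow> 0) (at_right 0)"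
  proof -
    \<comment> \<open>Only \<open>r v r \<rightarrow> 0\<close> is known, so \<open>v \<phi>\<close> is written as \<open>(r v) (\<phi> / r)\<close>.\<close>
    have "((\<lambda>r. sin (pi * r\<^sup>2) / r) \<longlongrightarrow> 0) (at_right (0::real))"
    proof (rule tendsto_0_le[where K = pi])
      show "((\<lambda>r. r) \<longlongrightarrow> 0) (at_right (0::real))" by (rule tendsto_ident_at)
      have "norm (sin (pi * r\<^sup>2) / r) \<le> norm r * pi" if "r > 0" for r :: real
      proof -
        have "\<bar>sin (pi * r\<^sup>2)\<bar> \<le> \<bar>pi * r\<^sup>2\<bar>" by (rule abs_sin_x_le_abs_x)
        then show ?thesis using that by (simp add: field_simps power2_eq_square abs_mult)
      qed
      then show "eventually (\<lambda>r::real. norm (sin (pi * r\<^sup>2) / r) \<le> norm r * pi) (at_right 0)"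
        unfolding eventually_at_right_field by (intro exI[of _ 1]) auto
    qed
    then have "((\<lambda>r. (r * v r) * (sin (pi * r\<^sup>2) / r) - 2 * pi * w r * cos (pi * r\<^sup>2))
        \<longlongrightarrow> 0 * 0 - 2 * pi * 0 * cos (pi * 0\<^sup>2)) (at_right 0)"
      by (intro tendsto_intros lim_rv w_tendsto_0)
    moreover have "eventually (\<lambda>r. (r * v r) * (sin (pi * r\<^sup>2) / r) - 2 * pi * w r * cos (pi * r\<^sup>2) = W r) (at_right 0)"
      using eventually_at_right_less[of 0] by eventually_elim (auto simp: W_def)
    ultimately show ?thesis by (auto dest: Lim_transform_eventually)
  qed
  have Wzero: "W r = 0" if r: "r \<in> {0<..1}" for r
  proof (rule antisym)
    show "W r \<le> 0" using mono[of r 1] r W1 by simp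
    have "eventually (\<lambda>s. W s \<le> W r) (at_right 0)"
      unfolding eventually_at_right_field using r mono by (intro exI[of _ r]) auto
    then show "0 \<le> W r" by (intro tendsto_upperbound[OF W0]) auto
  qed
  \<comment> \<open>A monotone function with equal end values is constant, but the derivative of \<open>W\<close> is positive
     at the interior point \<open>1/2\<close>.\<close>
  have "at (1/2) within {0<..1} = at (1/2::real)"
    by (intro at_within_open_subset[of _ "{0<..<1}"]) auto
  then have "(W has_real_derivative W' (1/2)) (at (1/2))" using DW[of "1/2"] by simp
  moreover have "(W has_real_derivative 0) (at (1/2))"
    by (rule has_field_derivative_transform_within_open[of "\<lambda>_. 0" 0 _ "{0<..<1}"])
       (auto simp: Wzero)
  ultimately have "W' (1/2) = 0" by (rule DERIV_unique)
  moreover have "sin (pi * (1/2)\<^sup>2) > 0" 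
    by (intro sin_gt_zero) (auto simp: power2_eq_square)
  ultimately show False using pos[of "1/2"] by (auto simp: W'_def)
qed

end


section \<open>The Green operator\<close>

text \<open>
  In the variables \<open>r\<close>, \<open>s\<close> the Green function of \<open>- d\<^sup>2/dt\<^sup>2\<close> on \<open>0 < t < 1/2\<close> with zero boundary values is
  \<open>min(r\<^sup>2, s\<^sup>2) (1 - max(r\<^sup>2, s\<^sup>2)) / 2\<close>. Splitting the integral of kernel times source at \<open>s = r\<close>
  leaves the weights \<open>s\<^sup>2\<close> on \<open>{0..r}\<close> and \<open>1 - s\<^sup>2\<close> on \<open>{r..1}\<close>. At \<open>s = 0\<close> the
  weighted source \<open>s\<^sup>2 * source lam y s\<close> is \<open>0\<close>, by the convention \<open>x / 0 = 0\<close>.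
\<close>
definition inner_part :: "real \<Rightarrow> (real \<Rightarrow> real) \<Rightarrow> real \<Rightarrow> real" where
  "inner_part lam y r = integral {0..r} (\<lambda>s. s\<^sup>2 * source lam y s)"

definition outer_part :: "real \<Rightarrow> (real \<Rightarrow> real) \<Rightarrow> real \<Rightarrow> real" where
  "outer_part lam y r = integral {r..1} (\<lambda>s. (1 - s\<^sup>2) * source lam y s)"

definition green :: "real \<Rightarrow> (real \<Rightarrow> real) \<Rightarrow> real \<Rightarrow> real" where
  "green lam y r = ((1 - r\<^sup>2) * inner_part lam y r + r\<^sup>2 * outer_part lam y r) / 2"

text \<open>
  The nonlinearity is increasing in \<open>y\<close> only for \<open>y \<ge> 0\<close>; this is why the iteration is carried
  out for \<open>y = - w\<close>.
\<close>
lemma source_mono: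
  assumes "r > 0" "0 \<le> y r" "y r \<le> z r"
  shows "source lam y r \<le> source lam z r"
  using assms unfolding source_def by (auto intro!: divide_right_mono power_mono)

section \<open>Existence below a supersolution\<close>

text \<open>
  \<open>Z = X' / r\<close> and \<open>G = - Z'\<close>, so \<open>source lam X \<le> G\<close> is the differential inequality for a
  supersolution. Keeping \<open>G\<close> as a parameter provides an explicit antiderivative for every
  integral of \<open>G\<close> that is used as a majorant.
\<close>
locale supersolution =
  fixes lam :: real and X Z G :: "real \<Rightarrow> real"
  assumes lam_nonneg: "lam \<ge> 0"
    and X_nonneg: "r \<in> {0<..1} \<Longrightarrow> X r \<ge> 0"
    and deriv_X: "r \<in> {0<..1} \<Longrightarrow> (X has_real_derivative r * Z r) (at r within {0<..1})"
    and deriv_Z: "r \<in> {0<..1} \<Longrightarrow> (Z has_real_derivative - G r) (at r within {0<..1})"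
    and source_le_G: "r \<in> {0<..1} \<Longrightarrow> source lam X r \<le> G r"
    and lim_X: "(X \<longlongrightarrow> 0) (at_right 0)"
    and lim_rZ: "((\<lambda>r. r * Z r) \<longlongrightarrow> 0) (at_right 0)"
    and X_1: "X 1 = 0"
begin

text \<open>
  An antiderivative of \<open>s\<^sup>2 G s\<close> is \<open>2 X s - s\<^sup>2 Z s\<close>. The boundary conditions at \<open>0\<close> make it
  continuous there with value \<open>0\<close>, so the fundamental theorem applies although \<open>G\<close> may be
  unbounded.
\<close>
lemma has_integral_inner_G:
  assumes r: "r \<in> {0<..1}"
  shows "((\<lambda>s. s\<^sup>2 * G s) has_integral (2 * X r - r\<^sup>2 * Z r)) {0..r}"
proof -
  define F where "F s = (if s = 0 then 0 else 2 * X s - s\<^sup>2 * Z s)" for s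
  have DF: "(F has_real_derivative s\<^sup>2 * G s) (at s within {0<..1})" if s: "s \<in> {0<..1}" for s
  proof (rule has_field_derivative_transform_within[of "\<lambda>s. 2 * X s - s\<^sup>2 * Z s" _ _ _ s])
    show "((\<lambda>s. 2 * X s - s\<^sup>2 * Z s) has_real_derivative s\<^sup>2 * G s) (at s within {0<..1})"
      by (rule derivative_eq_intros deriv_X[OF s] deriv_Z[OF s] refl)+
         (simp add: algebra_simps power2_eq_square)
  qed (use s in \<open>auto simp: F_def\<close>)
  have lim: "(F \<longlongrightarrow> F 0) (at_right 0)"
  proof -
    have "((\<lambda>s. 2 * X s - s * (s * Z s)) \<longlongrightarrow> 2 * 0 - 0 * 0) (at_right 0)"
      by (intro tendsto_intros lim_X lim_rZ)
    moreover have "eventually (\<lambda>s::real. 2 * X s - s * (s * Z s) = F s) (at_right 0)"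
      using eventually_at_right_less[of 0]
      by eventually_elim (auto simp: F_def power2_eq_square)
    ultimately have "(F \<longlongrightarrow> 2 * 0 - 0 * 0) (at_right 0)" by (rule Lim_transform_eventually)
    then show ?thesis by (simp add: F_def)
  qed
  have "continuous_on {0..r} F"
    unfolding continuous_on_eq_continuous_within
  proof
    fix s assume s: "s \<in> {0..r}"
    show "continuous (at s within {0..r}) F"
    proof (cases "s = 0")
      case True
      then show ?thesis using lim r by (simp add: continuous_within at_within_Icc_at_right)
    next
      case False
      have "continuous (at s within {0<..1}) F" using DF[of s] False s r
        by (intro DERIV_continuous) auto
      then have "continuous (at s within {0<..r}) F" by (rule continuous_within_subset) (use r in auto)
      moreover have "at s within {0<..r} = at s within {0..r}"
        using False s by (intro at_within_nhd[where S = "{0<..}"]) auto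
      ultimately show ?thesis by simp
    qed
  qed
  then have "((\<lambda>s. s\<^sup>2 * G s) has_integral F r - F 0) {0..r}"
  proof (rule fundamental_theorem_of_calculus_interior[rotated])
    fix s assume s: "s \<in> {0<..<r}"
    have "at s within {0<..1} = at s" using s r by (intro at_within_open_subset[of _ "{0<..<1}"]) auto
    then show "(F has_vector_derivative s\<^sup>2 * G s) (at s)"
      using DF[of s] s r by (simp add: has_real_derivative_iff_has_vector_derivative)
  qed (use r in auto)
  then show ?thesis using r by (simp add: F_def)
qed

text \<open>An antiderivative is \<open>- (1 - s\<^sup>2) Z s - 2 X s\<close>, which vanishes at \<open>1\<close>.\<close>
lemma has_integral_outer_G:
  assumes r: "r \<in> {0<..1}"
  shows "((\<lambda>s. (1 - s\<^sup>2) * G s) has_integral ((1 - r\<^sup>2) * Z r + 2 * X r)) {r..1}"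
proof -
  define F where "F s = - ((1 - s\<^sup>2) * Z s) - 2 * X s" for s
  have DF: "(F has_real_derivative (1 - s\<^sup>2) * G s) (at s within {r..1})" if s: "s \<in> {r..1}" for s
  proof -
    have s': "s \<in> {0<..1}" using s r by auto
    have "(F has_real_derivative (1 - s\<^sup>2) * G s) (at s within {0<..1})" unfolding F_def
      by (rule derivative_eq_intros deriv_X[OF s'] deriv_Z[OF s'] refl)+
         (simp add: algebra_simps power2_eq_square)
    then show ?thesis by (rule DERIV_subset) (use r in auto)
  qed
  have "((\<lambda>s. (1 - s\<^sup>2) * G s) has_integral F 1 - F r) {r..1}"
    using r DF by (intro fundamental_theorem_of_calculus)
      (auto simp: has_real_derivative_iff_has_vector_derivative)
  then show ?thesis by (simp add: F_def X_1 add.commute)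
qed

text \<open>
  The integrability conditions are part of the definition because the limit of the iterates is
  not known to be continuous, or even measurable, in advance.
\<close>
definition admissible :: "(real \<Rightarrow> real) \<Rightarrow> bool" where
  "admissible y \<longleftrightarrow> (\<forall>r\<in>{0<..1}. 0 \<le> y r \<and> y r \<le> X r) \<and>
     (\<lambda>s. s\<^sup>2 * source lam y s) integrable_on {0..1} \<and>
     (\<forall>r\<in>{0<..1}. (\<lambda>s. (1 - s\<^sup>2) * source lam y s) integrable_on {r..1})"

lemma source_le_G_below:
  assumes "\<And>r. r \<in> {0<..1} \<Longrightarrow> 0 \<le> y r \<and> y r \<le> X r" "s \<in> {0<..1}"
  shows "source lam y s \<le> G s"
  using source_mono[of s y X lam] source_le_G[of s] assms by force

lemma inner_dominated:
  assumes "\<And>r. r \<in> {0<..1} \<Longrightarrow> 0 \<le> y r \<and> y r \<le> X r" "s \<in> {0..1}"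
  shows "0 \<le> s\<^sup>2 * source lam y s" "s\<^sup>2 * source lam y s \<le> s\<^sup>2 * G s"
  using source_le_G_below[of y s] source_nonneg[OF lam_nonneg, of s y] assms
  by (cases "s = 0"; auto intro: mult_left_mono)+

lemma outer_dominated:
  assumes "\<And>r. r \<in> {0<..1} \<Longrightarrow> 0 \<le> y r \<and> y r \<le> X r" "s \<in> {0<..1}"
  shows "0 \<le> (1 - s\<^sup>2) * source lam y s" "(1 - s\<^sup>2) * source lam y s \<le> (1 - s\<^sup>2) * G s"
proof -
  have "s\<^sup>2 \<le> 1" using assms by (intro power_le_one) auto
  then show "0 \<le> (1 - s\<^sup>2) * source lam y s" "(1 - s\<^sup>2) * source lam y s \<le> (1 - s\<^sup>2) * G s"
    using source_le_G_below[of y s] source_nonneg[OF lam_nonneg, of s y] assms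
    by (auto intro!: mult_left_mono)
qed

text \<open>
  A continuous \<open>y\<close> below \<open>X\<close> has a measurable weighted source that is dominated by \<open>s\<^sup>2 G s\<close>, which
  is integrable up to \<open>0\<close>.
\<close>
lemma admissible_continuous:
  assumes bounds: "\<And>r. r \<in> {0<..1} \<Longrightarrow> 0 \<le> y r \<and> y r \<le> X r"
    and cont: "continuous_on {0<..1} y"
  shows "admissible y"
  unfolding admissible_def
proof (intro conjI ballI)
  have cs: "continuous_on {0<..1} (source lam y)"
    unfolding source_def by (intro continuous_intros cont) auto
  have Ioc: "f integrable_on {0<..1} \<longleftrightarrow> f integrable_on {0..1}" for f :: "real \<Rightarrow> real"
  proof -
    have "{0..1} = insert 0 {0<..1::real}" by auto
    then show ?thesis by (simp only: integrable_on_insert_iff)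
  qed
  have "(\<lambda>s. s\<^sup>2 * source lam y s) integrable_on {0<..1}"
  proof (rule measurable_bounded_by_integrable_imp_integrable)
    show "(\<lambda>s. s\<^sup>2 * source lam y s) \<in> borel_measurable (lebesgue_on {0<..1})"
      by (intro continuous_imp_measurable_on_sets_lebesgue continuous_intros cs) auto
    show "(\<lambda>s. s\<^sup>2 * G s) integrable_on {0<..1}"
      unfolding Ioc using has_integral_inner_G[of 1] by auto
    show "norm (s\<^sup>2 * source lam y s) \<le> s\<^sup>2 * G s" if "s \<in> {0<..1}" for s
      using inner_dominated[OF bounds, of s] that by auto
  qed auto
  then show "(\<lambda>s. s\<^sup>2 * source lam y s) integrable_on {0..1}"
    unfolding Ioc .
  show "(\<lambda>s. (1 - s\<^sup>2) * source lam y s) integrable_on {r..1}" if "r \<in> {0<..1}" for r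
    by (intro integrable_continuous_real continuous_intros continuous_on_subset[OF cs])
       (use that in auto)
qed (use bounds in auto)

text \<open>
  The upper bounds are the integrals of the majorant \<open>G\<close>. Besides bounding the iterates, they
  control the behaviour of the fixed point at \<open>0\<close>.
\<close>
lemma
  assumes y: "admissible y" and r: "r \<in> {0<..1}"
  shows inner_nonneg: "0 \<le> inner_part lam y r"
    and inner_le: "inner_part lam y r \<le> 2 * X r - r\<^sup>2 * Z r"
    and outer_nonneg: "0 \<le> outer_part lam y r"
    and outer_le: "outer_part lam y r \<le> (1 - r\<^sup>2) * Z r + 2 * X r"
proof -
  have b: "\<And>r. r \<in> {0<..1} \<Longrightarrow> 0 \<le> y r \<and> y r \<le> X r"
    and int: "(\<lambda>s. s\<^sup>2 * source lam y s) integrable_on {0..r}"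
      "(\<lambda>s. (1 - s\<^sup>2) * source lam y s) integrable_on {r..1}"
    using y r integrable_on_subinterval[of "\<lambda>s. s\<^sup>2 * source lam y s" "{0..1}" 0 r]
    unfolding admissible_def by auto
  show "0 \<le> inner_part lam y r" unfolding inner_part_def
    by (intro integral_nonneg int inner_dominated(1)[OF b]) (use r in auto)
  show "0 \<le> outer_part lam y r" unfolding outer_part_def
    by (intro integral_nonneg int outer_dominated(1)[OF b]) (use r in auto)
  show "inner_part lam y r \<le> 2 * X r - r\<^sup>2 * Z r" unfolding inner_part_def
    by (rule has_integral_le[OF integrable_integral[OF int(1)] has_integral_inner_G[OF r]])
       (use r in \<open>auto intro!: inner_dominated(2)[OF b]\<close>)
  show "outer_part lam y r \<le> (1 - r\<^sup>2) * Z r + 2 * X r" unfolding outer_part_def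
    by (rule has_integral_le[OF integrable_integral[OF int(2)] has_integral_outer_G[OF r]])
       (use r in \<open>auto intro!: outer_dominated(2)[OF b]\<close>)
qed

text \<open>
  In the upper bound the terms with \<open>Z\<close> cancel: applying the Green operator to \<open>G\<close> returns
  exactly \<open>X\<close>.
\<close>
lemma
  assumes y: "admissible y" and r: "r \<in> {0<..1}"
  shows green_nonneg: "0 \<le> green lam y r" and green_le: "green lam y r \<le> X r"
proof -
  have r2: "0 \<le> 1 - r\<^sup>2" using r power_le_one[of r 2] by simp
  show "0 \<le> green lam y r"
    unfolding green_def using r2 inner_nonneg[OF y r] outer_nonneg[OF y r] by simp
  have "(1 - r\<^sup>2) * inner_part lam y r + r\<^sup>2 * outer_part lam y r \<le>
     (1 - r\<^sup>2) * (2 * X r - r\<^sup>2 * Z r) + r\<^sup>2 * ((1 - r\<^sup>2) * Z r + 2 * X r)"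
    by (intro add_mono mult_left_mono r2 inner_le[OF y r] outer_le[OF y r]) auto
  also have "\<dots> = 2 * X r" by (simp add: algebra_simps)
  finally show "green lam y r \<le> X r" by (simp add: green_def)
qed

lemma
  assumes y: "admissible y"
  shows continuous_inner: "continuous_on {0<..1} (inner_part lam y)"
    and continuous_outer: "continuous_on {0<..1} (outer_part lam y)"
proof -
  have "continuous_on {0..1} (inner_part lam y)"
    using y unfolding admissible_def inner_part_def by (intro indefinite_integral_continuous_1) auto
  then show "continuous_on {0<..1} (inner_part lam y)" by (rule continuous_on_subset) auto
  show "continuous_on {0<..1} (outer_part lam y)"
    unfolding continuous_on_eq_continuous_within
  proof
    fix r :: real assume r: "r \<in> {0<..1}"
    have "continuous_on {r/2..1} (outer_part lam y)"
      using y r unfolding admissible_def outer_part_def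
      by (intro indefinite_integral_continuous_1') auto
    then have "continuous (at r within {r/2..1}) (outer_part lam y)"
      using r by (auto simp: continuous_on_eq_continuous_within)
    then show "continuous (at r within {0<..1}) (outer_part lam y)"
      using at_within_unit_eq[of "r/2" r] r by simp
  qed
qed

lemma continuous_green: "admissible y \<Longrightarrow> continuous_on {0<..1} (green lam y)"
  unfolding green_def by (intro continuous_intros continuous_inner continuous_outer) auto

lemma admissible_green: "admissible y \<Longrightarrow> admissible (green lam y)"
  using green_nonneg green_le continuous_green by (intro admissible_continuous) auto

lemma green_mono:
  assumes y: "admissible y" and z: "admissible z"
    and le: "\<And>r. r \<in> {0<..1} \<Longrightarrow> y r \<le> z r" and r: "r \<in> {0<..1}"
  shows "green lam y r \<le> green lam z r"
proof -
  have src: "source lam y s \<le> source lam z s" if "s \<in> {0<..1}" for s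
    using that y le[of s] by (intro source_mono) (auto simp: admissible_def)
  have int: "(\<lambda>s. s\<^sup>2 * source lam u s) integrable_on {0..r}"
      "(\<lambda>s. (1 - s\<^sup>2) * source lam u s) integrable_on {r..1}" if "admissible u" for u
    using that r integrable_on_subinterval[of "\<lambda>s. s\<^sup>2 * source lam u s" "{0..1}" 0 r]
    unfolding admissible_def by auto
  have r2: "0 \<le> 1 - s\<^sup>2" if "s \<in> {0<..1}" for s :: real using that power_le_one[of s 2] by simp
  have "inner_part lam y r \<le> inner_part lam z r" unfolding inner_part_def
  proof (rule integral_le[OF int(1)[OF y] int(1)[OF z]])
    fix s assume "s \<in> {0..r}"
    then show "s\<^sup>2 * source lam y s \<le> s\<^sup>2 * source lam z s"
      using r src[of s] by (cases "s = 0") (auto intro: mult_left_mono)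
  qed
  moreover have "outer_part lam y r \<le> outer_part lam z r" unfolding outer_part_def
    by (rule integral_le[OF int(2)[OF y] int(2)[OF z]])
       (use r in \<open>auto intro!: mult_left_mono src r2\<close>)
  ultimately show ?thesis unfolding green_def
    using r2[OF r] by (intro divide_right_mono add_mono mult_left_mono) auto
qed

text \<open>
  The operator is continuous under pointwise limits, by dominated convergence with the majorants
  \<open>s\<^sup>2 G s\<close> and \<open>(1 - s\<^sup>2) G s\<close>. Dominated convergence also yields the integrability that
  admissibility of the limit demands.
\<close>
lemma
  assumes adm: "\<And>n. admissible (x n)" and lim: "\<And>r. r \<in> {0<..1} \<Longrightarrow> (\<lambda>n. x n r) \<longlonglongrightarrow> y r"
  shows admissible_limit: "admissible y"
    and green_limit: "r \<in> {0<..1} \<Longrightarrow> (\<lambda>n. green lam (x n) r) \<longlonglongrightarrow> green lam y r"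
proof -
  have b: "0 \<le> x n r \<and> x n r \<le> X r" if "r \<in> {0<..1}" for n r
    using adm[of n] that unfolding admissible_def by auto
  have src: "(\<lambda>n. source lam (x n) s) \<longlonglongrightarrow> source lam y s" if "s \<in> {0<..1}" for s
    unfolding source_def using that by (intro tendsto_intros lim) auto
  have src_inner: "(\<lambda>n. s\<^sup>2 * source lam (x n) s) \<longlonglongrightarrow> s\<^sup>2 * source lam y s" if "s \<in> {0..1}" for s
    using that src[of s] by (cases "s = 0") (auto intro: tendsto_intros)
  have int_inner: "(\<lambda>s. s\<^sup>2 * source lam (x n) s) integrable_on {0..r}" if "r \<in> {0<..1}" for n r
    using adm[of n] that integrable_on_subinterval[of "\<lambda>s. s\<^sup>2 * source lam (x n) s" "{0..1}" 0 r]
    unfolding admissible_def by auto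
  have inner: "(\<lambda>s. s\<^sup>2 * source lam y s) integrable_on {0..r} \<and>
      (\<lambda>n. inner_part lam (x n) r) \<longlonglongrightarrow> inner_part lam y r" if r: "r \<in> {0<..1}" for r
  proof -
    have G: "(\<lambda>s. s\<^sup>2 * G s) integrable_on {0..r}" using has_integral_inner_G[OF r] by blast
    have le: "norm (s\<^sup>2 * source lam (x n) s) \<le> s\<^sup>2 * G s" if "s \<in> {0..r}" for n s
      using inner_dominated[of "x n" s, OF b] that r by simp
    show ?thesis unfolding inner_part_def
      using dominated_convergence[OF int_inner[OF r] G le src_inner] r by simp
  qed
  have outer: "(\<lambda>s. (1 - s\<^sup>2) * source lam y s) integrable_on {r..1} \<and>
      (\<lambda>n. outer_part lam (x n) r) \<longlonglongrightarrow> outer_part lam y r" if r: "r \<in> {0<..1}" for r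
  proof -
    have G: "(\<lambda>s. (1 - s\<^sup>2) * G s) integrable_on {r..1}" using has_integral_outer_G[OF r] by blast
    have int: "(\<lambda>s. (1 - s\<^sup>2) * source lam (x n) s) integrable_on {r..1}" for n
      using adm[of n] r unfolding admissible_def by blast
    have le: "norm ((1 - s\<^sup>2) * source lam (x n) s) \<le> (1 - s\<^sup>2) * G s" if "s \<in> {r..1}" for n s
      using outer_dominated[of "x n" s, OF b] that r by simp
    have conv: "(\<lambda>n. (1 - s\<^sup>2) * source lam (x n) s) \<longlonglongrightarrow> (1 - s\<^sup>2) * source lam y s"
      if "s \<in> {r..1}" for s
      using src[of s] that r by (intro tendsto_intros) auto
    show ?thesis unfolding outer_part_def
      using dominated_convergence[OF int G le conv] by blast
  qed
  have "0 \<le> y r \<and> y r \<le> X r" if r: "r \<in> {0<..1}" for r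
    using LIMSEQ_le_const[OF lim[OF r], of 0] LIMSEQ_le_const2[OF lim[OF r], of "X r"] b[OF r] by auto
  then show "admissible y" unfolding admissible_def using inner[of 1] outer by auto
  show "(\<lambda>n. green lam (x n) r) \<longlonglongrightarrow> green lam y r" if r: "r \<in> {0<..1}" for r
    unfolding green_def using inner[OF r] outer[OF r] by (intro tendsto_intros) auto
qed

text \<open>
  Monotone iteration from the subsolution \<open>0\<close>: the iterates increase and are bounded by \<open>X\<close>, so
  they converge pointwise.
\<close>
lemma green_fixed_point:
  obtains y where "admissible y" "\<And>r. r \<in> {0<..1} \<Longrightarrow> green lam y r = y r"
proof -
  define x where "x n = (green lam ^^ n) (\<lambda>_. 0)" for n
  have x_Suc: "x (Suc n) = green lam (x n)" for n by (simp add: x_def)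
  have adm: "admissible (x n)" for n
    by (induction n) (auto simp: x_Suc admissible_green, 
        auto simp: x_def intro!: admissible_continuous X_nonneg)
  have mono: "x n r \<le> x (Suc n) r" if "r \<in> {0<..1}" for n r
    using that
  proof (induction n arbitrary: r)
    case 0
    then show ?case using green_nonneg[OF adm[of 0]] by (simp add: x_Suc) (simp add: x_def)
  next
    case (Suc n)
    then show ?case unfolding x_Suc[of "Suc n"] x_Suc[of n]
      by (intro green_mono adm admissible_green) (auto simp: x_Suc)
  qed
  have "convergent (\<lambda>n. x n r)" if r: "r \<in> {0<..1}" for r
  proof -
    have "incseq (\<lambda>n. x n r)" using mono[OF r] by (intro incseq_SucI)
    moreover have "x n r \<le> X r" for n using adm[of n] r by (auto simp: admissible_def)
    ultimately show ?thesis by (metis convergent_def incseq_convergent)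
  qed
  then have lim: "(\<lambda>n. x n r) \<longlonglongrightarrow> lim (\<lambda>n. x n r)" if "r \<in> {0<..1}" for r
    using that convergent_LIMSEQ_iff by blast
  have "green lam (\<lambda>r. lim (\<lambda>n. x n r)) r = lim (\<lambda>n. x n r)" if r: "r \<in> {0<..1}" for r
    by (rule LIMSEQ_unique[OF green_limit[OF adm lim r], unfolded x_Suc[symmetric]])
       (use LIMSEQ_Suc[OF lim[OF r]] in auto)
  then show ?thesis using that[of "\<lambda>r. lim (\<lambda>n. x n r)"] admissible_limit[OF adm lim] by blast
qed

text \<open>
  A fixed point is continuous because its image is, and then the fundamental theorem gives
  \<open>A' = r\<^sup>2 g\<close> and \<open>B' = - (1 - r\<^sup>2) g\<close> for its inner part \<open>A\<close>, outer part \<open>B\<close> and source \<open>g\<close>. Hence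
  \<open>y' = r (B - A)\<close> and \<open>(A - B)' = g\<close>: the slope belonging to \<open>w = - y\<close> is \<open>A - B\<close>. The condition
  \<open>r (A - B) \<rightarrow> 0\<close> follows by comparison with the integrals of \<open>G\<close>.
\<close>
lemma solution_exists: "\<exists>w. solution_D lam w"
proof -
  obtain y where y: "admissible y" and fp: "\<And>r. r \<in> {0<..1} \<Longrightarrow> green lam y r = y r"
    using green_fixed_point by blast
  have cont: "continuous_on {0<..1} y"
    using continuous_on_eq[OF continuous_green[OF y] fp] .
  then have cs: "continuous_on {0<..1} (source lam y)"
    unfolding source_def by (intro continuous_intros) auto
  let ?A = "inner_part lam y" and ?B = "outer_part lam y"
  have DA: "(?A has_real_derivative r\<^sup>2 * source lam y r) (at r within {0<..1})"
    if r: "r \<in> {0<..1}" for r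
  proof -
    have "((\<lambda>u. integral {0..u} (\<lambda>s. s\<^sup>2 * source lam y s)) has_vector_derivative r\<^sup>2 * source lam y r)
        (at r within ({0..1} - {0}))"
    proof (rule integral_has_vector_derivative_continuous_at)
      have "{0..1} - {0} = {0<..1::real}" by auto
      moreover have "continuous_on {0<..1} (\<lambda>s. s\<^sup>2 * source lam y s)"
        by (intro continuous_intros cs)
      ultimately show "continuous (at r within {0..1} - {0}) (\<lambda>s. s\<^sup>2 * source lam y s)"
        using r by (simp add: continuous_on_eq_continuous_within)
    qed (use y r in \<open>auto simp: admissible_def\<close>)
    moreover have "{0..1} - {0} = {0<..1::real}" by auto
    ultimately show ?thesis
      by (simp add: has_real_derivative_iff_has_vector_derivative inner_part_def[abs_def])
  qed
  have DB: "(?B has_real_derivative - ((1 - r\<^sup>2) * source lam y r)) (at r within {0<..1})"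
    if r: "r \<in> {0<..1}" for r
  proof -
    have "continuous_on {r/2..1} (\<lambda>s. (1 - s\<^sup>2) * source lam y s)"
      by (intro continuous_intros continuous_on_subset[OF cs]) (use r in auto)
    then have "(?B has_real_derivative - ((1 - r\<^sup>2) * source lam y r)) (at r within {r/2..1})"
      unfolding outer_part_def[abs_def] using r by (intro integral_has_real_derivative') auto
    then show ?thesis using at_within_unit_eq[of "r/2" r] r by simp
  qed
  have "solution_D lam (\<lambda>r. - y r)" unfolding solution_D_iff_slope source_uminus
  proof (intro exI[of _ "\<lambda>r. ?A r - ?B r"] conjI ballI)
    fix r :: real assume r: "r \<in> {0<..1}"
    have "((\<lambda>r. - green lam y r) has_real_derivative r * (?A r - ?B r)) (at r within {0<..1})"
      unfolding green_def
      by (rule derivative_eq_intros DA[OF r] DB[OF r] refl | simp)+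
         (simp add: field_simps power2_eq_square)
    then show "((\<lambda>r. - y r) has_real_derivative r * (?A r - ?B r)) (at r within {0<..1})"
      by (rule has_field_derivative_transform_within[where d = 1]) (use r fp in auto)
    show "((\<lambda>r. ?A r - ?B r) has_real_derivative source lam y r) (at r within {0<..1})"
      by (rule derivative_eq_intros DA[OF r] DB[OF r] refl)+ (simp add: algebra_simps)
  next
    have ev: "eventually (\<lambda>r::real. r \<in> {0<..1}) (at_right 0)"
      unfolding eventually_at_right_field by (intro exI[of _ 1]) auto
    have "((\<lambda>r. ?A r) \<longlongrightarrow> 0) (at_right 0)"
    proof (rule tendsto_sandwich[OF _ _ tendsto_const])
      show "eventually (\<lambda>r. 0 \<le> ?A r) (at_right 0)"
        using ev by eventually_elim (rule inner_nonneg[OF y])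
      show "eventually (\<lambda>r. ?A r \<le> 2 * X r - r * (r * Z r)) (at_right 0)"
        using ev by eventually_elim (use inner_le[OF y] in \<open>simp add: power2_eq_square mult.assoc\<close>)
      have "((\<lambda>r. 2 * X r - r * (r * Z r)) \<longlongrightarrow> 2 * 0 - 0 * 0) (at_right 0)"
        by (intro tendsto_intros lim_X lim_rZ)
      then show "((\<lambda>r. 2 * X r - r * (r * Z r)) \<longlongrightarrow> 0) (at_right 0)" by simp
    qed
    moreover have "((\<lambda>r. r * ?B r) \<longlongrightarrow> 0) (at_right 0)"
    proof (rule tendsto_sandwich[OF _ _ tendsto_const])
      show "eventually (\<lambda>r. 0 \<le> r * ?B r) (at_right 0)"
        using ev by eventually_elim (use outer_nonneg[OF y] in simp)
      show "eventually (\<lambda>r. r * ?B r \<le> (1 - r\<^sup>2) * (r * Z r) + 2 * r * X r) (at_right 0)"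
        using ev
      proof eventually_elim
        fix r :: real assume r: "r \<in> {0<..1}"
        have "r * ?B r \<le> r * ((1 - r\<^sup>2) * Z r + 2 * X r)"
          using r by (intro mult_left_mono outer_le[OF y]) auto
        then show "r * ?B r \<le> (1 - r\<^sup>2) * (r * Z r) + 2 * r * X r" by (simp add: algebra_simps)
      qed
      have "((\<lambda>r. (1 - r\<^sup>2) * (r * Z r) + 2 * r * X r) \<longlongrightarrow> (1 - 0\<^sup>2) * 0 + 2 * 0 * 0) (at_right 0)"
        by (intro tendsto_intros lim_X lim_rZ)
      then show "((\<lambda>r. (1 - r\<^sup>2) * (r * Z r) + 2 * r * X r) \<longlongrightarrow> 0) (at_right 0)" by simp
    qed
    ultimately have "((\<lambda>r. r * ?A r - r * ?B r) \<longlongrightarrow> 0 * 0 - 0) (at_right 0)"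
      by (intro tendsto_intros)
    then show "((\<lambda>r. r * (?A r - ?B r)) \<longlongrightarrow> 0) (at_right 0)"
      by (simp add: right_diff_distrib)
  next
    have "\<forall>r\<in>{0<..1}. 0 \<le> y r \<and> y r \<le> X r" using y unfolding admissible_def by (rule conjunct1)
    from bspec[OF this, of 1] show "- y 1 = 0" using X_1 by simp
  qed
  then show ?thesis by (rule exI[of "solution_D lam"])
qed

end

section \<open>The set of solvable parameters\<close>
lemma solution_D_imp_solution:
  assumes "solution_D lam w" "lam \<ge> 0"
  shows "\<exists>v. solution lam w v"
proof -
  obtain v where "(\<forall>r\<in>{0<..1}. (w has_real_derivative r * v r) (at r within {0<..1})) \<and>
          (\<forall>r\<in>{0<..1}. (v has_real_derivative source lam w r) (at r within {0<..1})) \<and>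
          ((\<lambda>r. r * v r) \<longlongrightarrow> 0) (at_right 0) \<and> w 1 = 0"
    using assms(1) unfolding solution_D_iff_slope by (rule exE)
  then have "solution lam w v" using assms(2) by unfold_locales simp_all
  then show ?thesis by (rule exI[of "solution lam w"])
qed

text \<open>
  The negative of a solution for \<open>mu\<close> satisfies the equation with \<open>G = source mu w\<close>, and lowering
  the parameter only decreases the source.
\<close>
lemma solvable_downward:
  assumes "solution_D mu w" "0 \<le> lam" "lam \<le> mu"
  shows "\<exists>w. solution_D lam w"
proof -
  have "0 \<le> mu" using assms by simp
  from solution_D_imp_solution[OF assms(1) this] obtain v where "solution mu w v" by (rule exE)
  then interpret solution mu w v .
  have "supersolution lam (\<lambda>r. - w r) (\<lambda>r. - v r) (source mu w)"
  proof
    fix r :: real assume r: "r \<in> {0<..1}"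
    show "0 \<le> - w r" using w_nonpos[OF r] by simp
    show "((\<lambda>r. - w r) has_real_derivative r * - v r) (at r within {0<..1})"
      using DERIV_minus[OF deriv_w[OF r]] by simp
    show "((\<lambda>r. - v r) has_real_derivative - source mu w r) (at r within {0<..1})"
      by (rule DERIV_minus[OF deriv_v[OF r]])
    show "source lam (\<lambda>r. - w r) r \<le> source mu w r"
      using r assms by (simp add: source_def)
  next
    show "((\<lambda>r. - w r) \<longlongrightarrow> 0) (at_right 0)" using tendsto_minus[OF w_tendsto_0] by simp
    show "((\<lambda>r. r * - v r) \<longlongrightarrow> 0) (at_right 0)" using tendsto_minus[OF lim_rv] by simp
  qed (use assms w_1 in auto)
  then show ?thesis by (rule supersolution.solution_exists)
qed

text \<open>
  In the variable \<open>t\<close> this supersolution is the concave parabola \<open>t (1/2 - t)\<close>. Its second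
  derivative is \<open>- 2\<close>, which leaves ample room for \<open>1/2\<close> plus the small quadratic term.
\<close>
lemma solvable_one: "\<exists>w. solution_D 1 w"
proof -
  have "supersolution 1 (\<lambda>r. r\<^sup>2 * (1 - r\<^sup>2) / 4) (\<lambda>r. (1 - 2 * r\<^sup>2) / 2) (\<lambda>r. 2 * r)"
  proof
    fix r :: real assume r: "r \<in> {0<..1}"
    then have r2: "0 \<le> r\<^sup>2" "r\<^sup>2 \<le> 1" using power_le_one[of r 2] by auto
    show "0 \<le> r\<^sup>2 * (1 - r\<^sup>2) / 4" using r2 by simp
    show "((\<lambda>r. r\<^sup>2 * (1 - r\<^sup>2) / 4) has_real_derivative r * ((1 - 2 * r\<^sup>2) / 2)) (at r within {0<..1})"
      by (rule derivative_eq_intros refl | simp)+ (simp add: field_simps power2_eq_square)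
    show "((\<lambda>r. (1 - 2 * r\<^sup>2) / 2) has_real_derivative - (2 * r)) (at r within {0<..1})"
      by (rule derivative_eq_intros refl | simp)+
    have "source 1 (\<lambda>r. r\<^sup>2 * (1 - r\<^sup>2) / 4) r = r / 2 + r * (1 - r\<^sup>2)\<^sup>2 / 32"
      using r by (simp add: source_def field_simps power2_eq_square eval_nat_numeral)
    also have "\<dots> \<le> r / 2 + r * 1 / 32"
      using r r2 by (intro add_left_mono divide_right_mono mult_left_mono power_le_one) auto
    also have "\<dots> \<le> 2 * r" using r by simp
    finally show "source 1 (\<lambda>r. r\<^sup>2 * (1 - r\<^sup>2) / 4) r \<le> 2 * r" .
  next
    have "((\<lambda>r::real. r\<^sup>2 * (1 - r\<^sup>2) / 4) \<longlongrightarrow> 0\<^sup>2 * (1 - 0\<^sup>2) / 4) (at_right 0)"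
      by (intro tendsto_intros) auto
    then show "((\<lambda>r::real. r\<^sup>2 * (1 - r\<^sup>2) / 4) \<longlongrightarrow> 0) (at_right 0)" by simp
    have "((\<lambda>r::real. r * ((1 - 2 * r\<^sup>2) / 2)) \<longlongrightarrow> 0 * ((1 - 2 * 0\<^sup>2) / 2)) (at_right 0)"
      by (intro tendsto_intros) auto
    then show "((\<lambda>r::real. r * ((1 - 2 * r\<^sup>2) / 2)) \<longlongrightarrow> 0) (at_right 0)" by simp
  qed auto
  then show ?thesis by (rule supersolution.solution_exists)
qed

theorem theorem4p1:
  shows "(\<exists>lam0::real. lam0 > 0 \<and>
            (\<forall>lam\<in>{0..<lam0}. \<exists>w. solution_D lam w) \<and>
            (\<forall>lam>lam0. \<not> (\<exists>w. solution_D lam w))) \<and>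
         (\<forall>lam\<ge>0. \<forall>w. solution_D lam w \<longrightarrow>
            (\<forall>r\<in>{0<..1}. w r \<le> 0) \<and> (w \<longlongrightarrow> 0) (at_right 0))"
proof (rule conjI)
  define S where "S = {lam. lam \<ge> 0 \<and> (\<exists>w. solution_D lam w)}"
  have one: "1 \<in> S" using solvable_one by (simp add: S_def)
  have bdd: "bdd_above S"
  proof (rule bdd_aboveI)
    fix lam assume "lam \<in> S"
    then obtain w where "solution_D lam w" "lam \<ge> 0" by (auto simp: S_def)
    from solution_D_imp_solution[OF this] obtain v where "solution lam w v" by (rule exE)
    then show "lam \<le> 16 * pi ^ 4" by (rule solution.lam_bound)
  qed
  show "\<exists>lam0::real. lam0 > 0 \<and> (\<forall>lam\<in>{0..<lam0}. \<exists>w. solution_D lam w) \<and>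
            (\<forall>lam>lam0. \<not> (\<exists>w. solution_D lam w))"
  proof (intro exI[of _ "Sup S"] conjI ballI allI impI)
    have "1 \<le> Sup S" by (rule cSup_upper[OF one bdd])
    then show pos: "Sup S > 0" by simp
    fix lam assume lam: "lam \<in> {0..<Sup S}"
    then obtain mu where "mu \<in> S" "lam < mu" using less_cSup_iff[of S lam] one bdd by auto
    then show "\<exists>w. solution_D lam w" using lam solvable_downward[of mu _ lam] by (auto simp: S_def)
  next
    fix lam assume lam: "Sup S < lam"
    have "0 \<le> Sup S" using cSup_upper[OF one bdd] by simp
    then show "\<not> (\<exists>w. solution_D lam w)" using lam cSup_upper[OF _ bdd, of lam] by (auto simp: S_def)
  qed
  show "\<forall>lam\<ge>0. \<forall>w. solution_D lam w \<longrightarrow>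
            (\<forall>r\<in>{0<..1}. w r \<le> 0) \<and> (w \<longlongrightarrow> 0) (at_right 0)"
  proof (intro allI impI)
    fix lam :: real and w assume "0 \<le> lam" "solution_D lam w"
    from solution_D_imp_solution[OF this(2,1)] obtain v where "solution lam w v" by (rule exE)
    then interpret solution lam w v .
    show "(\<forall>r\<in>{0<..1}. w r \<le> 0) \<and> (w \<longlongrightarrow> 0) (at_right 0)"
      using w_nonpos w_tendsto_0 by simp
  qed
qed

end
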